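(* Let $m\geq0$ and $n\geq1$ be integers and $0\leq k\leq n+m-1$. The bijection $\Phi_{n,m}$ restricts to a bijection between $\mathcal{C}_{n,m}^{k}$ and $\mathcal{T}_{n,m}^{k}$. In particular, for $1\le r\le n+m$, \[ \sum_{b\in\mathcal{T}_{n,m}^k}t^{U_r(b)}=\sum_{c\in\mathcal{C}_{n,m}^k}t^{\overline U_r(c)}. \]
   Context: $\mathcal{C}_{n,m}$ is the set of plane partitions $c=(c_{ij})_{i,j\geq1}$ (nonnegative integer arrays with finitely many nonzero entries, weakly decreasing along rows and columns) with at most $n$ nonzero columns, nonzero entries strictly decreasing down columns, and each nonzero entry in column $j$ at most $n+m-j$. $\mathcal{C}_{n,m}^k$ is the subset of those $c$ having at most $k$ nonzero rows. $\mathcal{T}_{n,m}$ is the set of arrays $b=(b_{ij})_{1\leq i\leq j\leq n+m-1}$ of integers weakly decreasing along rows and columns with $\max\{n-i,0\}\le b_{ij}\le n$; $\mathcal{T}_{n,m}^k$ is the subset of those $b$ with $b_{ij}=n$ for all $j\le n+m-1-k$. $\Phi_{n,m}:\mathcal{C}_{n,m}\to\mathcal{T}_{n,m}$ maps $c$ to $b$ with $b_{ij}=n-\#\{l: c_{n+m-j,l}\ge 1-i+j\}$. For $b\in\mathcal{T}_{n,m}$, with $b_{i,n+m}=n-i$, $b_{0,j}=n$, $U_r(b)=\sum_{s=1}^{n+m-r}(b_{s,s+r-1}-b_{s,s+r})+\sum_{s=n+m-r+1}^{n+m-1}\chi\{b_{s,n+m-1}>n-s\}$; and $\overline U_r(c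)=n+m-1-U_r(\Phi_{n,m}(c))$.
   Formalization: The left-hand exponent U_r(b) is corrected to n+m-1-U_r(b), as the bijection and the definition of \overline U_r force; the printed identity fails for n=m=1, k=0, r=1, where it would read t=1. *)

theory Defs
  imports Main "HOL-Computational_Algebra.Formal_Laurent_Series"
begin

text \<open>
  Arrays are indexed from 1, as in the mathematics, and are total functions on
  \<open>nat \<times> nat\<close>. Entries outside the index range are fixed to be 0, so that an array is
  determined by its entries inside the range and equality of functions is equality of arrays.
\<close>

definition plane_partition :: "(nat \<Rightarrow> nat \<Rightarrow> nat) \<Rightarrow> bool" where
  "plane_partition c \<longleftrightarrow>
     (\<forall>i j. i = 0 \<or> j = 0 \<longrightarrow> c i j = 0) \<and>
     finite {(i, j). c i j \<noteq> 0} \<and>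
     (\<forall>i\<ge>1. \<forall>j\<ge>1. c i (j + 1) \<le> c i j) \<and>
     (\<forall>i\<ge>1. \<forall>j\<ge>1. c (i + 1) j \<le> c i j)"

definition nonzero_rows :: "(nat \<Rightarrow> nat \<Rightarrow> nat) \<Rightarrow> nat set" where
  "nonzero_rows c = {i. \<exists>j. c i j \<noteq> 0}"

definition nonzero_columns :: "(nat \<Rightarrow> nat \<Rightarrow> nat) \<Rightarrow> nat set" where
  "nonzero_columns c = {j. \<exists>i. c i j \<noteq> 0}"

definition CSPP :: "nat \<Rightarrow> nat \<Rightarrow> (nat \<Rightarrow> nat \<Rightarrow> nat) set" where
  "CSPP n m = {c. plane_partition c \<and>
     card (nonzero_columns c) \<le> n \<and>
     (\<forall>i i' j. i < i' \<and> c i j \<noteq> 0 \<and> c i' j \<noteq> 0 \<longrightarrow> c i' j < c i j) \<and>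
     (\<forall>i j. c i j \<noteq> 0 \<longrightarrow> int (c i j) \<le> int n + int m - int j)}"

definition CSPP_rows :: "nat \<Rightarrow> nat \<Rightarrow> nat \<Rightarrow> (nat \<Rightarrow> nat \<Rightarrow> nat) set" where
  "CSPP_rows n m k = {c \<in> CSPP n m. card (nonzero_rows c) \<le> k}"

definition tri_index :: "nat \<Rightarrow> nat \<Rightarrow> nat \<Rightarrow> nat \<Rightarrow> bool" where
  "tri_index n m i j \<longleftrightarrow> 1 \<le> i \<and> i \<le> j \<and> j \<le> n + m - 1"

definition Tri :: "nat \<Rightarrow> nat \<Rightarrow> (nat \<Rightarrow> nat \<Rightarrow> int) set" where
  "Tri n m = {b.
     (\<forall>i j. \<not> tri_index n m i j \<longrightarrow> b i j = 0) \<and>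
     (\<forall>i j. tri_index n m i j \<longrightarrow> max (int n - int i) 0 \<le> b i j \<and> b i j \<le> int n) \<and>
     (\<forall>i j. tri_index n m i j \<and> tri_index n m i (j + 1) \<longrightarrow> b i (j + 1) \<le> b i j) \<and>
     (\<forall>i j. tri_index n m i j \<and> tri_index n m (i + 1) j \<longrightarrow> b (i + 1) j \<le> b i j)}"

definition Tri_flat :: "nat \<Rightarrow> nat \<Rightarrow> nat \<Rightarrow> (nat \<Rightarrow> nat \<Rightarrow> int) set" where
  "Tri_flat n m k = {b \<in> Tri n m.
     \<forall>i j. tri_index n m i j \<and> int j \<le> int n + int m - 1 - int k \<longrightarrow> b i j = int n}"

definition Phi :: "nat \<Rightarrow> nat \<Rightarrow> (nat \<Rightarrow> nat \<Rightarrow> nat) \<Rightarrow> nat \<Rightarrow> nat \<Rightarrow> int" where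
  "Phi n m c i j = (if tri_index n m i j
     then int n - int (card {l. 1 \<le> l \<and> int (c (n + m - j) l) \<ge> 1 - int i + int j})
     else 0)"

text \<open>
  The extra column \<open>b\<^sub>i\<^sub>,\<^sub>n\<^sub>+\<^sub>m = n - i\<close> may have negative entries, so everything is kept
  integer-valued. The convention \<open>b\<^sub>0\<^sub>,\<^sub>j = n\<close> is part of the border but plays no role in \<open>U\<close>.
\<close>

definition bordered :: "nat \<Rightarrow> nat \<Rightarrow> (nat \<Rightarrow> nat \<Rightarrow> int) \<Rightarrow> nat \<Rightarrow> nat \<Rightarrow> int" where
  "bordered n m b i j =
     (if i = 0 then int n else if j = n + m then int n - int i else b i j)"

definition U :: "nat \<Rightarrow> nat \<Rightarrow> nat \<Rightarrow> (nat \<Rightarrow> nat \<Rightarrow> int) \<Rightarrow> int" where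
  "U n m r b =
     (\<Sum>s = 1..n + m - r. bordered n m b s (s + r - 1) - bordered n m b s (s + r)) +
     (\<Sum>s = n + m - r + 1..n + m - 1.
        of_bool (bordered n m b s (n + m - 1) > int n - int s))"

definition Ubar :: "nat \<Rightarrow> nat \<Rightarrow> nat \<Rightarrow> (nat \<Rightarrow> nat \<Rightarrow> nat) \<Rightarrow> int" where
  "Ubar n m r c = int n + int m - 1 - U n m r (Phi n m c)"

lemma finite_Tri: "finite (Tri n m)"
proof -
  let ?A = "{..n + m} \<times> {..n + m}" and ?B = "{0..int n}"
  have "finite {f. \<forall>x. (x \<in> ?A \<longrightarrow> f x \<in> ?B) \<and> (x \<notin> ?A \<longrightarrow> f x = (0::int))}"
    by (rule finite_set_of_finite_funs) auto
  moreover have "Tri n m \<subseteq> curry ` {f. \<forall>x. (x \<in> ?A \<longrightarrow> f x \<in> ?B) \<and> (x \<notin> ?A \<longrightarrow> f x = 0)}"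
  proof
    fix b assume b: "b \<in> Tri n m"
    have "0 \<le> b i j \<and> b i j \<le> int n" for i j
      using b by (cases "tri_index n m i j") (auto simp: Tri_def)
    moreover have "b i j = 0" if "\<not> (i \<le> n + m \<and> j \<le> n + m)" for i j
    proof -
      have "\<not> tri_index n m i j" using that by (auto simp: tri_index_def)
      then show ?thesis using b by (simp add: Tri_def)
    qed
    ultimately show "b \<in> curry ` {f. \<forall>x. (x \<in> ?A \<longrightarrow> f x \<in> ?B) \<and> (x \<notin> ?A \<longrightarrow> f x = 0)}"
      by (intro image_eqI[where x = "case_prod b"]) auto
  qed
  ultimately show ?thesis by (meson finite_imageI finite_subset)
qed

text \<open>
  Since \<open>Ubar\<close> is the complement of \<open>U \<circ> Phi\<close> with respect to \<open>n + m - 1\<close>, the bijection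
  \<open>Phi\<close> identifies the generating function of \<open>Ubar\<close> with that of the complemented exponent
  \<open>n + m - 1 - U\<close>, not with that of \<open>U\<close> itself. The source prints the identity with exponent
  \<open>U\<close> on the triangular arrays; the next lemma shows that this version is false already for
  \<open>n = m = 1\<close>, \<open>k = 0\<close>, \<open>r = 1\<close>, where each side has a single term and it would read \<open>t = 1\<close>.
\<close>

lemma uncomplemented_identity_fails:
  "(\<Sum>b\<in>Tri_flat 1 1 0. (fls_X_intpow (U 1 1 1 b) :: int fls)) \<noteq>
   (\<Sum>c\<in>CSPP_rows 1 1 0. fls_X_intpow (Ubar 1 1 1 c))"
proof -
  have ti: "tri_index 1 1 i j \<longleftrightarrow> i = 1 \<and> j = 1" for i j
    by (auto simp: tri_index_def)
  let ?b = "\<lambda>i j. if i = 1 \<and> j = (1::nat) then 1 else (0::int)"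
  have "Tri_flat 1 1 0 = {?b}"
    by (auto simp: Tri_flat_def Tri_def ti[simplified] fun_eq_iff)
  moreover have "U 1 1 1 ?b = 1"
    by (simp add: U_def bordered_def)
  moreover have "CSPP_rows 1 1 0 = {\<lambda>i j. 0}"
  proof -
    have "c = (\<lambda>i j. 0)" if c: "c \<in> CSPP_rows 1 1 0" for c
    proof -
      have "finite {(i, j). c i j \<noteq> 0}" "card (nonzero_rows c) = 0"
        using c by (auto simp: CSPP_rows_def CSPP_def plane_partition_def)
      moreover have "nonzero_rows c = fst ` {(i, j). c i j \<noteq> 0}"
        by (force simp: nonzero_rows_def)
      ultimately have "nonzero_rows c = {}" by simp
      then show ?thesis by (auto simp: nonzero_rows_def fun_eq_iff)
    qed
    moreover have "(\<lambda>i j. 0) \<in> CSPP_rows 1 1 0"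
      by (simp add: CSPP_rows_def CSPP_def plane_partition_def nonzero_rows_def nonzero_columns_def)
    ultimately show ?thesis by blast
  qed
  moreover have "Ubar 1 1 1 (\<lambda>i j. 0) = 0"
    by (simp add: Ubar_def U_def bordered_def Phi_def ti[simplified])
  moreover have "(fls_X_intpow 1 :: int fls) \<noteq> fls_X_intpow 0"
    by (auto simp: fls_eq_iff dest: spec[of _ 0])
  ultimately show ?thesis by simp
qed

end

theory Submission
  imports Defs
begin

text \<open>
  Column \<open>j\<close> of \<open>n - Phi n m c\<close>, read from the diagonal upwards, is the conjugate of the partition
  in row \<open>n + m - j\<close> of \<open>c\<close>. Conjugation is a Galois connection: the \<open>v\<close>-th conjugate part is at
  least \<open>l\<close> iff the \<open>l\<close>-th part is at least \<open>v\<close>. Through this equivalence the inequalities defining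
  the two families of arrays translate into each other, and conjugating back gives surjectivity.
\<close>

text \<open>A finite down-closed set of positive integers is the initial segment up to its
  cardinality. This is the Galois connection behind conjugation, used both for \<open>Phi\<close>
  and for its inverse.\<close>

lemma le_card_iff:
  fixes P :: "nat \<Rightarrow> bool"
  assumes down: "\<And>l. 1 \<le> l \<Longrightarrow> P (Suc l) \<Longrightarrow> P l"
    and fin: "finite {l. 1 \<le> l \<and> P l}"
    and l: "1 \<le> l"
  shows "l \<le> card {l. 1 \<le> l \<and> P l} \<longleftrightarrow> P l"
proof
  have mono: "P a" if "a \<le> b" "1 \<le> a" "P b" for a b
    using that by (induction rule: inc_induct) (auto intro: down)
  show "P l" if le: "l \<le> card {l. 1 \<le> l \<and> P l}"
  proof (rule ccontr)
    assume "\<not> P l"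
    then have "{l. 1 \<le> l \<and> P l} \<subseteq> {1..<l}"
      using mono[OF _ l] by (auto simp: not_le[symmetric])
    from card_mono[OF _ this] show False using le l by simp
  qed
  show "l \<le> card {l. 1 \<le> l \<and> P l}" if "P l"
  proof -
    have "{1..l} \<subseteq> {l. 1 \<le> l \<and> P l}" using mono that by auto
    from card_mono[OF fin this] show ?thesis by simp
  qed
qed

text \<open>Turns the bounds on the numbers of nonzero rows and columns into bounds on the indices
  of nonzero entries.\<close>

lemma card_down_closed_le_iff:
  fixes S :: "nat set"
  assumes fin: "finite S" and zero: "0 \<notin> S"
    and down: "\<And>l. 1 \<le> l \<Longrightarrow> Suc l \<in> S \<Longrightarrow> l \<in> S"
  shows "card S \<le> k \<longleftrightarrow> (\<forall>l\<in>S. l \<le> k)"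
proof -
  have S: "{l. 1 \<le> l \<and> l \<in> S} = S"
    using zero by (auto simp: Suc_le_eq intro: gr0I)
  have "l \<le> card S" if l: "l \<in> S" for l
  proof -
    have "1 \<le> l" using l zero by (cases l) auto
    from le_card_iff[of "\<lambda>l. l \<in> S", unfolded S, OF down fin this] l show ?thesis by blast
  qed
  moreover have "card S \<le> k" if "\<forall>l\<in>S. l \<le> k"
  proof -
    have "S \<subseteq> {1..k}" using that S by auto
    from card_mono[OF _ this] show ?thesis by simp
  qed
  ultimately show ?thesis by (meson order_trans)
qed

text \<open>The conjugation equivalences speak only of \<open>l >= 1\<close>, so inequalities
  between entries are tested on positive \<open>l\<close>. For \<open>x <= 0\<close> the test is
  vacuous, and \<open>0 <= y\<close> settles that case.\<close>

lemma int_le_via_positive: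
  fixes x y :: int
  assumes "0 \<le> y" and "\<And>l::nat. 1 \<le> l \<Longrightarrow> int l \<le> x \<Longrightarrow> int l \<le> y"
  shows "x \<le> y"
proof (cases "x \<le> 0")
  case False
  then show ?thesis using assms(2)[of "nat x"] by simp
qed (use assms(1) in simp)

lemma card_nonzero_rows_le_iff:
  assumes "plane_partition c"
  shows "card (nonzero_rows c) \<le> k \<longleftrightarrow> (\<forall>i j. c i j \<noteq> 0 \<longrightarrow> i \<le> k)"
proof -
  have "nonzero_rows c = fst ` {(i, j). c i j \<noteq> 0}" by (force simp: nonzero_rows_def)
  then have fin: "finite (nonzero_rows c)" using assms by (simp add: plane_partition_def)
  have zero: "0 \<notin> nonzero_rows c"
    using assms by (auto simp: nonzero_rows_def plane_partition_def)
  have down: "l \<in> nonzero_rows c" if l: "1 \<le> l" "Suc l \<in> nonzero_rows c" for l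
  proof -
    obtain j where j: "c (Suc l) j \<noteq> 0" using l by (auto simp: nonzero_rows_def)
    then have "1 \<le> j" using assms by (cases j) (auto simp: plane_partition_def)
    then have "c (Suc l) j \<le> c l j" using assms l by (simp add: plane_partition_def)
    then show ?thesis using j by (auto simp: nonzero_rows_def intro!: exI[of _ j])
  qed
  have "card (nonzero_rows c) \<le> k \<longleftrightarrow> (\<forall>l\<in>nonzero_rows c. l \<le> k)"
    using fin zero down by (rule card_down_closed_le_iff)
  then show ?thesis by (auto simp: nonzero_rows_def)
qed

lemma card_nonzero_columns_le_iff:
  assumes "plane_partition c"
  shows "card (nonzero_columns c) \<le> k \<longleftrightarrow> (\<forall>i j. c i j \<noteq> 0 \<longrightarrow> j \<le> k)"
proof -
  have "nonzero_columns c = nonzero_rows (\<lambda>i j. c j i)"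
    by (simp add: nonzero_rows_def nonzero_columns_def)
  moreover have "plane_partition (\<lambda>i j. c j i)"
  proof -
    have "{(i, j). c j i \<noteq> 0} = prod.swap ` {(i, j). c i j \<noteq> 0}" by (auto simp: image_iff)
    then have "finite {(i, j). c j i \<noteq> 0}" using assms by (simp add: plane_partition_def)
    then show ?thesis using assms by (simp add: plane_partition_def)
  qed
  ultimately show ?thesis using card_nonzero_rows_le_iff by auto
qed

text \<open>Strict decrease costs at least 1 per row, so the bound \<open>n + m - j\<close> in row 1
  sharpens to \<open>n + m + 1 - i - j\<close> in row \<open>i\<close>. This sharper form is what
  matches the triangular index range and the lower bound \<open>n - i\<close>.\<close>

lemma CSPP_rows_iff:
  "c \<in> CSPP_rows n m k \<longleftrightarrow>
     (\<forall>i j. c i j \<noteq> 0 \<longrightarrow> 1 \<le> i \<and> 1 \<le> j \<and> i \<le> k \<and> j \<le> n \<and> i + j + c i j \<le> n + m + 1) \<and>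
     (\<forall>i\<ge>1. \<forall>j\<ge>1. c i (Suc j) \<le> c i j) \<and>
     (\<forall>i\<ge>1. \<forall>j\<ge>1. c (Suc i) j \<noteq> 0 \<longrightarrow> c (Suc i) j < c i j)"
  (is "?L \<longleftrightarrow> ?R")
proof
  assume ?L
  then have pp: "plane_partition c" and cols: "card (nonzero_columns c) \<le> n"
    and rows: "card (nonzero_rows c) \<le> k"
    and strict: "\<And>i i' j. i < i' \<Longrightarrow> c i j \<noteq> 0 \<Longrightarrow> c i' j \<noteq> 0 \<Longrightarrow> c i' j < c i j"
    and bound: "\<And>i j. c i j \<noteq> 0 \<Longrightarrow> int (c i j) \<le> int n + int m - int j"
    by (auto simp: CSPP_rows_def CSPP_def)
  have pos: "1 \<le> i \<and> 1 \<le> j" if "c i j \<noteq> 0" for i j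
    using that pp unfolding plane_partition_def by (metis One_nat_def Suc_leI gr0I)
  have desc: "c (Suc i) j < c i j" if "1 \<le> i" "1 \<le> j" "c (Suc i) j \<noteq> 0" for i j
  proof -
    have "c (Suc i) j \<le> c i j" using pp that by (simp add: plane_partition_def)
    then show ?thesis using strict[of i "Suc i" j] that by simp
  qed
  have sum: "i + j + c i j \<le> n + m + 1" if "c i j \<noteq> 0" "1 \<le> j" "1 \<le> i" for i j
    using that(3,1)
  proof (induction i rule: dec_induct)
    case base
    then show ?case using bound[of 1 j] by simp
  next
    case (step i)
    then have "c (Suc i) j < c i j" using desc that(2) by blast
    then show ?case using step by simp
  qed
  show ?R
    using pos sum desc pp cols rows
    by (simp add: card_nonzero_columns_le_iff card_nonzero_rows_le_iff)
      (simp add: plane_partition_def)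
next
  assume R: ?R
  have dec: "c (Suc i) j \<le> c i j" if "1 \<le> i" "1 \<le> j" for i j
    using R that by (cases "c (Suc i) j = 0") (auto intro: less_imp_le)
  have "{(i, j). c i j \<noteq> 0} \<subseteq> {..k} \<times> {..n}" using R by auto
  then have "finite {(i, j). c i j \<noteq> 0}" by (rule finite_subset) auto
  moreover have "c i j = 0" if "i = 0 \<or> j = 0" for i j
    using R that by (metis not_one_le_zero)
  ultimately have pp: "plane_partition c"
    using R dec by (simp add: plane_partition_def)
  have strict: "c i' j < c i j" if "i < i'" "c i j \<noteq> 0" "c i' j \<noteq> 0" for i i' j
  proof -
    have j: "1 \<le> i" "1 \<le> j" using R that by blast+
    have "Suc i \<le> i'" using that by simp
    then show ?thesis using that(3)
    proof (induction i' rule: dec_induct)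
      case base
      then show ?case using R j by blast
    next
      case (step l)
      then have "c (Suc l) j < c l j" using R j by auto
      then show ?case using step by simp
    qed
  qed
  have bound: "int (c i j) \<le> int n + int m - int j" if "c i j \<noteq> 0" for i j
  proof -
    have "1 \<le> i" "i + j + c i j \<le> n + m + 1" using R that by blast+
    then show ?thesis by linarith
  qed
  show ?L
    unfolding CSPP_rows_def CSPP_def
    using R pp strict bound card_nonzero_columns_le_iff[OF pp] card_nonzero_rows_le_iff[OF pp]
    by auto
qed

text \<open>The threshold \<open>v = j + 1 - i\<close> is positive because \<open>i <= j\<close>.
  Hence only nonzero entries are counted and the counted set is finite; it is down-closed because
  rows of \<open>c\<close> decrease weakly.\<close>

lemma le_Phi_iff:
  assumes c: "c \<in> CSPP_rows n m k" and ij: "tri_index n m i j" and l: "1 \<le> l"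
  shows "int l \<le> int n - Phi n m c i j \<longleftrightarrow> Suc j - i \<le> c (n + m - j) l"
proof -
  have v: "int (c (n + m - j) l) \<ge> 1 - int i + int j \<longleftrightarrow> Suc j - i \<le> c (n + m - j) l" for l
    using ij by (auto simp: tri_index_def)
  have row: "1 \<le> n + m - j" "1 \<le> Suc j - i" using ij by (auto simp: tri_index_def)
  have fin: "finite {l. 1 \<le> l \<and> Suc j - i \<le> c (n + m - j) l}"
  proof (rule finite_subset)
    have "c (n + m - j) l \<noteq> 0 \<longrightarrow> l \<le> n" for l
      using c unfolding CSPP_rows_iff by blast
    then show "{l. 1 \<le> l \<and> Suc j - i \<le> c (n + m - j) l} \<subseteq> {..n}" using row by fastforce
  qed simp
  have down: "Suc j - i \<le> c (n + m - j) l" if "1 \<le> l" "Suc j - i \<le> c (n + m - j) (Suc l)" for l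
    using c row that unfolding CSPP_rows_iff by (meson order_trans)
  have "int n - Phi n m c i j = int (card {l. 1 \<le> l \<and> Suc j - i \<le> c (n + m - j) l})"
    using ij by (simp add: Phi_def v)
  then show ?thesis
    using le_card_iff[of "\<lambda>l. Suc j - i \<le> c (n + m - j) l", OF down fin l] by simp
qed

text \<open>Strictness down the columns of \<open>c\<close> yields monotone rows of
  \<open>b\<close>, while columns of \<open>b\<close> are monotone because the threshold drops as
  \<open>i\<close> grows. The bounds on columns, entries and rows of \<open>c\<close> give
  \<open>b >= 0\<close>, \<open>b >= n - i\<close> and flatness.\<close>

lemma Phi_in_Tri_flat:
  assumes c: "c \<in> CSPP_rows n m k"
  shows "Phi n m c \<in> Tri_flat n m k"
proof -
  let ?b = "Phi n m c"
  have supp: "1 \<le> i \<and> 1 \<le> j \<and> i \<le> k \<and> j \<le> n \<and> i + j + c i j \<le> n + m + 1" if "c i j \<noteq> 0" for i j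
    using c that unfolding CSPP_rows_iff by blast
  have strict: "c (Suc i) j < c i j" if "c (Suc i) j \<noteq> 0" "1 \<le> i" "1 \<le> j" for i j
    using c that unfolding CSPP_rows_iff by blast
  have nonneg: "?b i j \<le> int n" if "tri_index n m i j" for i j
    using that by (simp add: Phi_def)
  \<comment> \<open>With \<open>p = n + m - j\<close> and \<open>v = j + 1 - i\<close>, the bound
    \<open>p + l + v <= n + m + 1\<close> is exactly \<open>l <= i\<close>.\<close>
  have le: "int l \<le> int n \<and> int l \<le> int i" if ij: "tri_index n m i j"
    and l: "1 \<le> l" "int l \<le> int n - ?b i j" for i j l
  proof -
    have "Suc j - i \<le> c (n + m - j) l" using le_Phi_iff[OF c ij] l by blast
    moreover have "c (n + m - j) l \<noteq> 0" using calculation ij by (auto simp: tri_index_def)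
    ultimately show ?thesis using supp[of "n + m - j" l] ij by (auto simp: tri_index_def)
  qed
  have lower: "max (int n - int i) 0 \<le> ?b i j" if ij: "tri_index n m i j" for i j
    using int_le_via_positive[of "int n" "int n - ?b i j"]
      int_le_via_positive[of "int i" "int n - ?b i j"] le[OF ij] by auto
  have row: "?b i (j + 1) \<le> ?b i j" if ij: "tri_index n m i j" "tri_index n m i (j + 1)" for i j
  proof -
    have "int n - ?b i j \<le> int n - ?b i (j + 1)"
    proof (rule int_le_via_positive)
      fix l :: nat assume l: "1 \<le> l" "int l \<le> int n - ?b i j"
      have N: "n + m - j = Suc (n + m - (j + 1))" "1 \<le> n + m - (j + 1)" "1 \<le> Suc j - i"
        using ij by (auto simp: tri_index_def)
      have v: "Suc j - i \<le> c (n + m - j) l" using le_Phi_iff[OF c ij(1)] l by blast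
      \<comment> \<open>Moving from column \<open>j\<close> to \<open>j + 1\<close> goes one row up
        in \<open>c\<close> and raises the threshold by one; the strict increase of the entry pays
        for this.\<close>
      then have "c (n + m - j) l < c (n + m - (j + 1)) l"
        using strict[of "n + m - (j + 1)" l] N l by simp
      with v have "Suc (j + 1) - i \<le> c (n + m - (j + 1)) l" by linarith
      then show "int l \<le> int n - ?b i (j + 1)" using le_Phi_iff[OF c ij(2)] l by blast
    qed (use nonneg ij in simp)
    then show ?thesis by simp
  qed
  have col: "?b (i + 1) j \<le> ?b i j" if ij: "tri_index n m i j" "tri_index n m (i + 1) j" for i j
  proof -
    have "int n - ?b i j \<le> int n - ?b (i + 1) j"
    proof (rule int_le_via_positive)
      fix l :: nat assume l: "1 \<le> l" "int l \<le> int n - ?b i j"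
      have "Suc j - i \<le> c (n + m - j) l" using le_Phi_iff[OF c ij(1)] l by blast
      then show "int l \<le> int n - ?b (i + 1) j" using le_Phi_iff[OF c ij(2)] l by simp
    qed (use nonneg ij in simp)
    then show ?thesis by simp
  qed
  have flat: "?b i j = int n" if ij: "tri_index n m i j" and j: "int j \<le> int n + int m - 1 - int k"
    for i j
  proof -
    \<comment> \<open>Here row \<open>n + m - j\<close> lies beyond row \<open>k\<close>, so it is
      zero and meets no positive threshold.\<close>
    have "int n - ?b i j \<le> 0"
    proof (rule int_le_via_positive)
      fix l :: nat assume l: "1 \<le> l" "int l \<le> int n - ?b i j"
      have "Suc j - i \<le> c (n + m - j) l" using le_Phi_iff[OF c ij] l by blast
      then show "int l \<le> 0"
        using supp[of "n + m - j" l] ij j by (cases "c (n + m - j) l = 0") (auto simp: tri_index_def)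
    qed simp
    then show ?thesis using nonneg[OF ij] by simp
  qed
  show ?thesis
    unfolding Tri_flat_def Tri_def
    using nonneg lower row col flat by (simp add: Phi_def)
qed

lemma inj_on_Phi: "inj_on (Phi n m) (CSPP_rows n m k)"
proof (rule inj_onI)
  fix c c' assume c: "c \<in> CSPP_rows n m k" and c': "c' \<in> CSPP_rows n m k"
    and eq: "Phi n m c = Phi n m c'"
  have le: "d p l \<le> d' p l" if d: "d \<in> CSPP_rows n m k" and d': "d' \<in> CSPP_rows n m k"
    and e: "Phi n m d = Phi n m d'" for d d' p l
  proof (cases "d p l = 0")
    case False
    then have bd: "1 \<le> p" "1 \<le> l" "p + l + d p l \<le> n + m + 1"
      using d unfolding CSPP_rows_iff by blast+
    \<comment> \<open>The indices are chosen so that the threshold equals the entry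
      \<open>d p l\<close> itself; the bound on \<open>p + l + d p l\<close> keeps
      \<open>?i >= 1\<close>. Equality of the images then forces \<open>d' p l\<close> to reach the
      same threshold.\<close>
    let ?j = "n + m - p" and ?i = "Suc (n + m - p) - d p l"
    have ij: "tri_index n m ?i ?j" and "Suc ?j - ?i = d p l" "n + m - ?j = p"
      using bd False by (auto simp: tri_index_def)
    then show ?thesis using le_Phi_iff[OF d ij bd(2)] le_Phi_iff[OF d' ij bd(2)] e by auto
  qed simp
  show "c = c'" using le[OF c c' eq] le[OF c' c eq[symmetric]] by (auto intro!: ext antisym)
qed

text \<open>Row \<open>p\<close> is the conjugate of column \<open>n + m - p\<close> of
  \<open>n - b\<close>, with \<open>v = 1\<close> on the diagonal and \<open>v = n + m - p\<close>
  in the top row. The cap on \<open>v\<close> keeps the default value 0 outside the triangle from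
  being counted.\<close>

definition Phi_inv :: "nat \<Rightarrow> nat \<Rightarrow> (nat \<Rightarrow> nat \<Rightarrow> int) \<Rightarrow> nat \<Rightarrow> nat \<Rightarrow> nat" where
  "Phi_inv n m b p l = (if 1 \<le> p \<and> 1 \<le> l
     then card {v. 1 \<le> v \<and> v \<le> n + m - p \<and> int l \<le> int n - b (Suc (n + m - p) - v) (n + m - p)}
     else 0)"

text \<open>Lowering \<open>v\<close> moves down a column of \<open>b\<close>, where
  \<open>n - b\<close> grows, so the counted set is down-closed.\<close>

lemma le_Phi_inv_iff:
  assumes b: "b \<in> Tri n m" and v: "1 \<le> v"
  shows "v \<le> Phi_inv n m b p l \<longleftrightarrow>
    1 \<le> p \<and> 1 \<le> l \<and> v \<le> n + m - p \<and> int l \<le> int n - b (Suc (n + m - p) - v) (n + m - p)"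
proof (cases "1 \<le> p \<and> 1 \<le> l")
  case True
  let ?P = "\<lambda>v. v \<le> n + m - p \<and> int l \<le> int n - b (Suc (n + m - p) - v) (n + m - p)"
  have down: "?P v" if "1 \<le> v" "?P (Suc v)" for v
  proof -
    let ?i = "n + m - p - v"
    have "tri_index n m ?i (n + m - p)" "tri_index n m (?i + 1) (n + m - p)"
      using that True by (auto simp: tri_index_def)
    then have "b (?i + 1) (n + m - p) \<le> b ?i (n + m - p)" using b by (auto simp: Tri_def)
    moreover have "v \<le> n + m - p" using that(2) by linarith
    then have "Suc (n + m - p) - v = ?i + 1" by linarith
    moreover have "v \<le> n + m - p" by fact
    ultimately show ?thesis using that by simp
  qed
  have "finite {v. 1 \<le> v \<and> ?P v}" by (rule finite_subset[of _ "{..n + m - p}"]) auto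
  from le_card_iff[of ?P, OF down this v] show ?thesis using True by (simp add: Phi_inv_def)
qed (use v in \<open>auto simp: Phi_inv_def\<close>)

lemma Phi_inv_in_CSPP_rows:
  assumes b: "b \<in> Tri_flat n m k"
  shows "Phi_inv n m b \<in> CSPP_rows n m k"
proof -
  let ?c = "Phi_inv n m b"
  have T: "b \<in> Tri n m" using b by (simp add: Tri_flat_def)
  note iff = le_Phi_inv_iff[OF T]
  have supp: "1 \<le> p \<and> 1 \<le> l \<and> p \<le> k \<and> l \<le> n \<and> p + l + ?c p l \<le> n + m + 1"
    if nz: "?c p l \<noteq> 0" for p l
  proof -
    let ?j = "n + m - p"
    \<comment> \<open>This is the highest row counted for \<open>?c p l\<close>. There
      \<open>b >= n - i\<close> gives \<open>l <= i\<close>, which is the sum bound, and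
      \<open>b >= 0\<close> gives \<open>l <= n\<close>.\<close>
    define i where "i = Suc ?j - ?c p l"
    have h: "1 \<le> p" "1 \<le> l" "?c p l \<le> ?j" "int l \<le> int n - b i ?j"
      using iff[of "?c p l" p l] nz by (auto simp: i_def)
    have ij: "tri_index n m i ?j" using h nz by (auto simp: tri_index_def i_def)
    then have "max (int n - int i) 0 \<le> b i ?j" using T by (auto simp: Tri_def)
    then have "l \<le> i" "l \<le> n" using h by auto
    moreover have "p \<le> k"
    proof (rule ccontr)
      assume "\<not> p \<le> k"
      then have "int ?j \<le> int n + int m - 1 - int k" using h nz by auto
      then have "b i ?j = int n" using b ij by (auto simp: Tri_flat_def)
      then show False using h by simp
    qed
    ultimately show ?thesis using h nz by (auto simp: i_def)
  qed
  have row: "?c p (Suc l) \<le> ?c p l" if "1 \<le> p" "1 \<le> l" for p l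
  proof (cases "?c p (Suc l) = 0")
    case False
    then show ?thesis using iff[of "?c p (Suc l)" p "Suc l"] iff[of "?c p (Suc l)" p l] that by auto
  qed simp
  have col: "?c (Suc p) l < ?c p l" if pl: "1 \<le> p" "1 \<le> l" and nz: "?c (Suc p) l \<noteq> 0" for p l
  proof -
    let ?v = "?c (Suc p) l" and ?j = "n + m - Suc p"
    \<comment> \<open>The right neighbour in row \<open>i\<close> is one step further from the
      diagonal, and \<open>b\<close> is no larger there. So \<open>?v + 1\<close> is counted for row
      \<open>p\<close>, which gives strictness.\<close>
    define i where "i = Suc ?j - ?v"
    have h: "?v \<le> ?j" "int l \<le> int n - b i ?j"
      using iff[of ?v "Suc p" l] nz by (auto simp: i_def)
    have "tri_index n m i ?j" "tri_index n m i (?j + 1)"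
      using h nz pl by (auto simp: tri_index_def i_def)
    then have "b i (?j + 1) \<le> b i ?j" using T by (auto simp: Tri_def)
    moreover have "?j + 1 = n + m - p" using h nz by auto
    moreover have "Suc (n + m - p) - Suc ?v = i" using h nz by (auto simp: i_def)
    ultimately have "Suc ?v \<le> ?c p l" using iff[of "Suc ?v" p l] pl h by auto
    then show ?thesis by simp
  qed
  show ?thesis unfolding CSPP_rows_iff using supp row col by blast
qed

lemma Phi_Phi_inv:
  assumes b: "b \<in> Tri n m"
  shows "Phi n m (Phi_inv n m b) = b"
proof (intro ext)
  fix i j
  show "Phi n m (Phi_inv n m b) i j = b i j"
  proof (cases "tri_index n m i j")
    case True
    have "1 - int i + int j \<le> int (Phi_inv n m b (n + m - j) l) \<longleftrightarrow> int l \<le> int n - b i j"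
      if "1 \<le> l" for l
    proof -
      have "1 - int i + int j \<le> int (Phi_inv n m b (n + m - j) l)
          \<longleftrightarrow> Suc j - i \<le> Phi_inv n m b (n + m - j) l"
        using True by (auto simp: tri_index_def)
      also have "\<dots> \<longleftrightarrow> int l \<le> int n - b i j"
        using le_Phi_inv_iff[OF b, of "Suc j - i" "n + m - j" l] True that
        by (auto simp: tri_index_def)
      finally show ?thesis .
    qed
    then have "{l. 1 \<le> l \<and> 1 - int i + int j \<le> int (Phi_inv n m b (n + m - j) l)}
        = {1..nat (int n - b i j)}"
      by auto
    \<comment> \<open>This makes \<open>nat (int n - b i j)\<close> exact, so the interval has
      \<open>n - b i j\<close> elements.\<close>
    moreover have "b i j \<le> int n" using b True by (auto simp: Tri_def)
    ultimately show ?thesis using True by (simp add: Phi_def)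
  next
    case False
    then show ?thesis using b by (simp add: Phi_def Tri_def)
  qed
qed

theorem theorem5p1:
  fixes n m k :: nat
  assumes "n \<ge> 1" and "k \<le> n + m - 1"
  shows "bij_betw (Phi n m) (CSPP_rows n m k) (Tri_flat n m k) \<and>
    (\<forall>r\<in>{1..n + m}.
       (\<Sum>b\<in>Tri_flat n m k. (fls_X_intpow (int n + int m - 1 - U n m r b) :: int fls)) =
       (\<Sum>c\<in>CSPP_rows n m k. fls_X_intpow (Ubar n m r c)))"
proof -
  have "Tri_flat n m k \<subseteq> Phi n m ` CSPP_rows n m k"
  proof
    fix b assume b: "b \<in> Tri_flat n m k"
    then have "b = Phi n m (Phi_inv n m b)" by (simp add: Phi_Phi_inv Tri_flat_def)
    then show "b \<in> Phi n m ` CSPP_rows n m k" using Phi_inv_in_CSPP_rows[OF b] by (rule image_eqI)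
  qed
  then have bij: "bij_betw (Phi n m) (CSPP_rows n m k) (Tri_flat n m k)"
    using inj_on_Phi Phi_in_Tri_flat by (auto simp: bij_betw_def)
  \<comment> \<open>By definition \<open>Ubar\<close> at \<open>c\<close> is the complemented
    exponent at \<open>Phi n m c\<close>, so the sums agree by reindexing along the
    bijection.\<close>
  then show ?thesis
    by (auto simp: Ubar_def sum.reindex_bij_betw[OF bij, symmetric])
qed

end
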